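(* Suppose that every connected graph $H$ satisfies $\min\left(s^{+}(H), s^{-}(H)\right) \ge |V(H)| - 1$. Then for any graph $G$ with $n$ vertices, \[ \frac{(n-1)^2}{2} < s^{+}(G) + s^{+}(\overline{G}) \le (n-1)^2 . \]
   Context: All graphs are finite, simple and undirected. For a graph $G$ on $n$ vertices with adjacency matrix $A$, let $\mu_1(G) \ge \dots \ge \mu_n(G)$ be the eigenvalues of $A$ counted with multiplicity. Define $s^{+}(G) = \sum_{i:\, \mu_i(G) > 0} \mu_i(G)^2$ and $s^{-}(G) = \sum_{i:\, \mu_i(G) < 0} \mu_i(G)^2$, the sums of the squares of the positive and of the negative eigenvalues of $A$ respectively. $V(H)$ denotes the vertex set of a graph $H$, and $\overline{G}$ denotes the complement of $G$. The inequality assumed for connected graphs is a conjecture; the theorem is conditional on it.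
   Formalization: The strict lower bound is stated only for n ≥ 2, since for the one-vertex graph it would read 0 < 0 (and for the empty graph 1/2 < 0); the upper bound is stated for every n. *)

theory Defs
  imports
    "Graph_Theory.Graph_Theory"
    "Jordan_Normal_Form.Char_Poly"
begin

text \<open>
  A finite simple undirected graph is a value \<open>G :: 'a pair_pre_digraph\<close> with
  \<open>pair_graph G\<close>: finitely many vertices, and a symmetric irreflexive set of arcs on them, so
  that an undirected edge is a pair of opposite arcs. The empty graph is allowed; it is not
  \<open>connected\<close>.
\<close>

definition graph_complement :: "'a pair_pre_digraph \<Rightarrow> 'a pair_pre_digraph" where
  "graph_complement G =
     \<lparr> pverts = pverts G,
       parcs = {(u, v). u \<in> pverts G \<and> v \<in> pverts G \<and> u \<noteq> v \<and> (u, v) \<notin> parcs G} \<rparr>"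

lemma pair_graph_complement:
  assumes "pair_graph G"
  shows "pair_graph (graph_complement G)"
proof -
  interpret pair_graph G by fact
  have "finite (parcs (graph_complement G))"
    by (rule finite_subset[of _ "pverts G \<times> pverts G"]) (auto simp: graph_complement_def)
  moreover have "sym (parcs G)"
    using pair_sym_arcs by (simp add: symmetric_def)
  ultimately show ?thesis
    by unfold_locales
      (auto simp: graph_complement_def symmetric_def intro!: symI dest: symD)
qed

definition adj_mat_list :: "'a pair_pre_digraph \<Rightarrow> 'a list \<Rightarrow> real mat" where
  "adj_mat_list G vs =
     mat (length vs) (length vs) (\<lambda>(i, j). if (vs ! i, vs ! j) \<in> parcs G then 1 else 0)"

text \<open>
  The rows and columns are labelled by an arbitrary enumeration of the vertices. By
  \<open>char_poly_adj_mat_list\<close> below, the spectrum does not depend on the choice.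
\<close>

definition adj_mat :: "'a pair_pre_digraph \<Rightarrow> real mat" where
  "adj_mat G = adj_mat_list G (SOME vs. distinct vs \<and> set vs = pverts G)"

text \<open>
  An eigenvalue is counted as often as it is a root of the characteristic polynomial. Real
  eigenvalues suffice since adjacency matrices are symmetric.
\<close>

definition s_plus :: "'a pair_pre_digraph \<Rightarrow> real" where
  "s_plus G = (\<Sum>\<mu> | eigenvalue (adj_mat G) \<mu> \<and> \<mu> > 0. real (order \<mu> (char_poly (adj_mat G))) * \<mu>\<^sup>2)"

definition s_minus :: "'a pair_pre_digraph \<Rightarrow> real" where
  "s_minus G = (\<Sum>\<mu> | eigenvalue (adj_mat G) \<mu> \<and> \<mu> < 0. real (order \<mu> (char_poly (adj_mat G))) * \<mu>\<^sup>2)"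

lemma sum_indicator_nth:
  fixes f :: "nat \<Rightarrow> real"
  assumes "distinct ws" "j < length ws"
  shows "(\<Sum>k = 0..<length ws. (if ws ! j = ws ! k then 1 else 0) * f k) = f j"
proof -
  have "(\<Sum>k = 0..<length ws. (if ws ! j = ws ! k then 1 else 0) * f k)
      = (\<Sum>k = 0..<length ws. if j = k then f k else 0)"
    using assms by (intro sum.cong) (auto simp: nth_eq_iff_index_eq)
  then show ?thesis using assms by simp
qed

lemma sum_nth_indicator:
  fixes f :: "nat \<Rightarrow> real"
  assumes "distinct ws" "j < length ws"
  shows "(\<Sum>k = 0..<length ws. f k * (if ws ! k = ws ! j then 1 else 0)) = f j"
proof -
  have "(\<Sum>k = 0..<length ws. f k * (if ws ! k = ws ! j then 1 else 0))
      = (\<Sum>k = 0..<length ws. if k = j then f k else 0)"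
    using assms by (intro sum.cong) (auto simp: nth_eq_iff_index_eq)
  then show ?thesis using assms by simp
qed

lemma char_poly_adj_mat_list:
  assumes vs: "distinct vs" and ws: "distinct ws" and eq: "set vs = set ws"
  shows "char_poly (adj_mat_list G vs) = char_poly (adj_mat_list G ws)"
proof -
  define n where "n = length vs"
  have lv: "length vs = n" and lw: "length ws = n"
    using distinct_card[OF vs] distinct_card[OF ws] eq by (auto simp: n_def)
  define T where "T xs ys = mat n n (\<lambda>(i, j). if xs ! i = ys ! j then 1 else (0::real))"
    for xs ys :: "'a list"
  have pos: "\<exists>k<n. xs ! i = ys ! k"
    if "set xs = set ys" "length xs = n" "length ys = n" "i < n" for xs ys :: "'a list" and i
    using that by (metis in_set_conv_nth)
  have row: "(T xs ys * M) $$ (i, j) = M $$ (k, j)"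
    if "distinct ys" "length ys = n" "M \<in> carrier_mat n n" "i < n" "j < n" "k < n"
      "xs ! i = ys ! k" for xs ys :: "'a list" and M i j k
    using that sum_indicator_nth[of ys k "\<lambda>l. M $$ (l, j)"]
    by (simp add: T_def scalar_prod_def)
  have TT: "T xs ys * T ys xs = 1\<^sub>m n"
    if h: "distinct xs" "distinct ys" "length xs = n" "length ys = n" "set xs = set ys"
    for xs ys :: "'a list"
  proof (rule eq_matI)
    fix i j assume "i < dim_row (1\<^sub>m n :: real mat)" "j < dim_col (1\<^sub>m n :: real mat)"
    then have ij: "i < n" "j < n" by auto
    obtain k where k: "k < n" "xs ! i = ys ! k"
      using pos[OF h(5,3,4) ij(1)] by blast
    have "(T xs ys * T ys xs) $$ (i, j) = T ys xs $$ (k, j)"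
      using h ij k by (intro row) (auto simp: T_def)
    also have "\<dots> = (1\<^sub>m n :: real mat) $$ (i, j)"
    proof -
      have "ys ! k = xs ! j \<longleftrightarrow> i = j"
        unfolding k(2)[symmetric] using h ij by (simp add: nth_eq_iff_index_eq)
      then show ?thesis using ij k by (simp add: T_def)
    qed
    finally show "(T xs ys * T ys xs) $$ (i, j) = (1\<^sub>m n :: real mat) $$ (i, j)" .
  qed (auto simp: T_def)
  have conj: "T vs ws * adj_mat_list G ws = adj_mat_list G vs * T vs ws"
  proof (rule eq_matI)
    fix i j assume "i < dim_row (adj_mat_list G vs * T vs ws)"
      "j < dim_col (adj_mat_list G vs * T vs ws)"
    then have ij: "i < n" "j < n" by (auto simp: adj_mat_list_def T_def lv)
    obtain k where k: "k < n" "vs ! i = ws ! k" using pos[OF eq lv lw ij(1)] by auto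
    obtain l where l: "l < n" "ws ! j = vs ! l" using pos[OF eq[symmetric] lw lv ij(2)] by auto
    have "(T vs ws * adj_mat_list G ws) $$ (i, j) = adj_mat_list G ws $$ (k, j)"
      using ij k by (intro row) (auto simp: ws lw adj_mat_list_def)
    also have "\<dots> = adj_mat_list G vs $$ (i, l)"
      using ij k l by (simp add: adj_mat_list_def lv lw)
    also have "\<dots> = (adj_mat_list G vs * T vs ws) $$ (i, j)"
    proof -
      have "(adj_mat_list G vs * T vs ws) $$ (i, j) =
          (\<Sum>m = 0..<n. adj_mat_list G vs $$ (i, m) * (if vs ! m = vs ! l then 1 else 0))"
        using ij l by (simp add: T_def scalar_prod_def adj_mat_list_def lv)
      also have "\<dots> = adj_mat_list G vs $$ (i, l)"
        using sum_nth_indicator[OF vs, of l] l by (simp add: lv)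
      finally show ?thesis by simp
    qed
    finally show "(T vs ws * adj_mat_list G ws) $$ (i, j) = (adj_mat_list G vs * T vs ws) $$ (i, j)" .
  qed (auto simp: T_def adj_mat_list_def lv lw)
  have Tc: "T vs ws \<in> carrier_mat n n" "T ws vs \<in> carrier_mat n n" by (auto simp: T_def)
  have Ac: "adj_mat_list G vs \<in> carrier_mat n n" "adj_mat_list G ws \<in> carrier_mat n n"
    by (auto simp: adj_mat_list_def lv lw)
  have "T vs ws * adj_mat_list G ws * T ws vs = adj_mat_list G vs * (T vs ws * T ws vs)"
    unfolding conj using Tc Ac by (simp add: assoc_mult_mat)
  also have "\<dots> = adj_mat_list G vs"
    using TT[OF vs ws lv lw eq] Ac by simp
  finally have "similar_mat_wit (adj_mat_list G vs) (adj_mat_list G ws) (T vs ws) (T ws vs)"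
    using TT[OF vs ws lv lw eq] TT[OF ws vs lw lv eq[symmetric]] Tc Ac
    by (auto simp: similar_mat_wit_def Let_def)
  then show ?thesis
    by (intro char_poly_similar) (auto simp: similar_mat_def)
qed

end

theory Submission
  imports
    Defs
    "Jordan_Normal_Form.Schur_Decomposition"
    "Jordan_Normal_Form.Spectral_Radius"
begin

text \<open>
  Write the adjacency matrices of \<open>G\<close> and its complement as \<open>P - N\<close> and \<open>Q - M\<close>, the positive and
  negative spectral parts. The squared norms of \<open>P\<close>, \<open>Q\<close> are the two values of \<open>s_plus\<close>, those of
  \<open>N\<close>, \<open>M\<close> the two values of \<open>s_minus\<close>, and all four add up to \<open>n (n - 1)\<close>.

  Upper bound: \<open>G\<close> or its complement is connected, so by the conjecture the values of \<open>s_minus\<close>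
  add up to at least \<open>n - 1\<close>.

  Lower bound: put \<open>X = P + Q\<close> and \<open>Y = N + M\<close>, so \<open>X - Y = J - I\<close> with \<open>J\<close> the all-ones matrix.
  The entries of \<open>Y\<close> have nonnegative sum, so those of \<open>X\<close> sum to at least \<open>n (n - 1)\<close>, and
  Cauchy-Schwarz gives \<open>(n - 1)\<^sup>2 \<le> \<parallel>X\<parallel>\<^sup>2 \<le> 2 (\<parallel>P\<parallel>\<^sup>2 + \<parallel>Q\<parallel>\<^sup>2)\<close>. Equality would force
  \<open>X = ((n - 1) / n) J\<close>, hence \<open>Y = I - J / n\<close> and \<open>\<parallel>Y\<parallel>\<^sup>2 = n - 1\<close>; but
  \<open>\<parallel>Y\<parallel>\<^sup>2 \<ge> \<parallel>N\<parallel>\<^sup>2 + \<parallel>M\<parallel>\<^sup>2 = (n\<^sup>2 - 1) / 2\<close>.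
\<close>

section \<open>Diagonalization of real symmetric matrices\<close>

text \<open>A complex eigenvalue exists because the field is algebraically closed. The Hermitian
  form of a real symmetric matrix takes only real values, so that eigenvalue is real and is a root
  of the real characteristic polynomial.\<close>

lemma symmetric_real_eigenvalue_exists:
  fixes A :: "real mat"
  assumes A: "A \<in> carrier_mat n n" and n: "n > 0"
    and sym: "\<And>i j. i < n \<Longrightarrow> j < n \<Longrightarrow> A $$ (i, j) = A $$ (j, i)"
  shows "\<exists>e. eigenvalue A e"
proof -
  define B where "B = map_mat complex_of_real A"
  have B: "B \<in> carrier_mat n n" using A by (auto simp: B_def)
  from spectrum_non_empty[OF B n] obtain e where e: "eigenvalue B e"
    by (auto simp: spectrum_def)
  then obtain v where v: "v \<in> carrier_vec n" "v \<noteq> 0\<^sub>v n" and Bv: "B *\<^sub>v v = e \<cdot>\<^sub>v v"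
    using B by (auto simp: eigenvalue_def eigenvector_def)
  define N where "N = (\<Sum>i<n. (cmod (v $ i))\<^sup>2)"
  define q where "q = (\<Sum>i<n. \<Sum>j<n. cnj (v $ i) * (of_real (A $$ (i, j)) * v $ j))"
  have "(\<Sum>j<n. of_real (A $$ (i, j)) * v $ j) = e * v $ i" if "i < n" for i
    using arg_cong[OF Bv, of "\<lambda>w. w $ i"] that A v
    by (simp add: B_def scalar_prod_def atLeast0LessThan)
  then have "q = (\<Sum>i<n. cnj (v $ i) * (e * v $ i))"
    by (simp add: q_def flip: sum_distrib_left)
  also have "\<dots> = e * of_real N"
    unfolding N_def of_real_sum sum_distrib_left
    by (intro sum.cong) (simp_all add: complex_norm_square mult_ac del: of_real_power)
  finally have q: "q = e * of_real N" .
  \<comment> \<open>Conjugation exchanges the two copies of \<open>v\<close>. Swapping the summation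
    indices and using the symmetry of \<open>A\<close> restores \<open>q\<close>, so
    \<open>q\<close> is real; since \<open>q\<close> is \<open>e\<close> times the squared norm
    \<open>N\<close> of \<open>v\<close>, so is \<open>e\<close>.\<close>
  have "cnj q = (\<Sum>i<n. \<Sum>j<n. v $ i * (of_real (A $$ (i, j)) * cnj (v $ j)))"
    by (simp add: q_def)
  also have "\<dots> = (\<Sum>j<n. \<Sum>i<n. v $ i * (of_real (A $$ (i, j)) * cnj (v $ j)))"
    by (rule sum.swap)
  also have "\<dots> = q"
    unfolding q_def by (intro sum.cong refl) (simp add: sym mult_ac)
  finally have "cnj e * of_real N = e * of_real N"
    unfolding q by simp
  moreover have "N \<noteq> 0"
  proof
    assume "N = 0"
    then have "\<forall>i<n. v $ i = 0" by (simp add: N_def sum_nonneg_eq_0_iff)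
    then have "v = 0\<^sub>v n" using v(1) by (intro eq_vecI) auto
    with v(2) show False by simp
  qed
  ultimately have "cnj e = e" by simp
  then have er: "e = of_real (Re e)" by (simp add: complex_eq_iff)
  have "poly (char_poly B) e = of_real (poly (char_poly A) (Re e))"
    by (subst er) (simp add: B_def of_real_hom.char_poly_hom[OF A])
  then have "poly (char_poly A) (Re e) = 0"
    using e eigenvalue_root_char_poly[OF B] by simp
  then show ?thesis using eigenvalue_root_char_poly[OF A] by blast
qed

text \<open>Complete \<open>v\<close> to a basis, apply Gram-Schmidt, which keeps the first vector,
  and normalize the columns. Only the direction of the first column matters later, so its scale
  \<open>c\<close> stays unspecified.\<close>

lemma orthogonal_mat_extending_vec:
  fixes v :: "real vec"
  assumes v: "v \<in> carrier_vec n" "v \<noteq> 0\<^sub>v n"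
  obtains W c where "W \<in> carrier_mat n n" "W\<^sup>T * W = 1\<^sub>m n" "col W 0 = c \<cdot>\<^sub>v v"
proof -
  interpret cof_vec_space n "TYPE(real)" .
  define b where "b = basis_completion v"
  define ws where "ws = gram_schmidt n b"
  note bc = basis_completion[OF v, folded b_def]
  have n: "n > 0" using v by (cases n) auto
  obtain vs where bv: "b = v # vs" using bc(6,7) n by (cases b) auto
  note gs = gram_schmidt_result[OF bc(2,4,5) ws_def]
  have len: "length ws = n" using gs(4) bc(6) by simp
  have "hd ws = v" using gram_schmidt_hd[OF v(1), of vs] by (simp add: ws_def bv)
  then have ws0: "ws ! 0 = v" using len n by (metis hd_conv_nth length_0_conv less_numeral_extra(3))
  have car: "ws ! j \<in> carrier_vec n" if "j < n" for j using gs(3) len that nth_mem by blast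
  define r where "r j = sqrt (ws ! j \<bullet> ws ! j)" for j
  define W where "W = mat n n (\<lambda>(i, j). ws ! j $ i / r j)"
  have W: "W \<in> carrier_mat n n" by (simp add: W_def)
  have orth: "(ws ! i \<bullet> ws ! j = 0) = (i \<noteq> j)" if "i < n" "j < n" for i j
    using corthogonalD[OF gs(2), of i j] that len by simp
  have "W\<^sup>T * W = 1\<^sub>m n"
  proof (rule eq_matI)
    fix i j assume "i < dim_row (1\<^sub>m n :: real mat)" "j < dim_col (1\<^sub>m n :: real mat)"
    then have ij: "i < n" "j < n" by auto
    have "(W\<^sup>T * W) $$ (i, j) = (ws ! i \<bullet> ws ! j) / (r i * r j)"
      using ij carrier_vecD[OF car[OF ij(2)]] by (simp add: W_def scalar_prod_def sum_divide_distrib)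
    also have "\<dots> = (1\<^sub>m n :: real mat) $$ (i, j)"
    proof (cases "i = j")
      case True
      have "ws ! j \<bullet> ws ! j \<ge> 0"
        by (simp add: scalar_prod_def sum_nonneg)
      then have "r j * r j = ws ! j \<bullet> ws ! j" by (simp add: r_def)
      then show ?thesis using True ij orth[of j j] by simp
    next
      case False
      then show ?thesis using ij orth by simp
    qed
    finally show "(W\<^sup>T * W) $$ (i, j) = (1\<^sub>m n :: real mat) $$ (i, j)" .
  qed (auto simp: W_def)
  moreover have "col W 0 = (1 / r 0) \<cdot>\<^sub>v v"
    using n v(1) by (intro eq_vecI) (auto simp: W_def ws0)
  ultimately show thesis using that W by blast
qed

text \<open>Induction on the dimension by deflation: an orthogonal change of basis whose first
  column is an eigenvector splits off a 1 by 1 block, and the remaining block is again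
  symmetric.\<close>

theorem symmetric_real_mat_diagonalization:
  fixes A :: "real mat"
  assumes "A \<in> carrier_mat n n"
    and "A\<^sup>T = A"
  obtains U d where "U \<in> carrier_mat n n" "U\<^sup>T * U = 1\<^sub>m n" "A = U * mat_diag n d * U\<^sup>T"
proof -
  have "\<exists>U d. U \<in> carrier_mat n n \<and> U\<^sup>T * U = 1\<^sub>m n \<and> A = U * mat_diag n d * U\<^sup>T"
    using assms
  proof (induction n arbitrary: A)
    case 0
    then show ?case by (intro exI[of _ "1\<^sub>m 0"]) (auto intro!: eq_matI)
  next
    case (Suc m)
    let ?n = "Suc m"
    note A = Suc.prems(1)
    have "A $$ (i, j) = A $$ (j, i)" if "i < ?n" "j < ?n" for i j
      using that A arg_cong[OF Suc.prems(2), of "\<lambda>M. M $$ (j, i)"] by simp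
    from symmetric_real_eigenvalue_exists[OF A _ this] obtain e where "eigenvalue A e" by auto
    then obtain v where v: "v \<in> carrier_vec ?n" "v \<noteq> 0\<^sub>v ?n" and Av: "A *\<^sub>v v = e \<cdot>\<^sub>v v"
      using A by (auto simp: eigenvalue_def eigenvector_def)
    obtain W c where W: "W \<in> carrier_mat ?n ?n" and WW: "W\<^sup>T * W = 1\<^sub>m ?n"
      and W0: "col W 0 = c \<cdot>\<^sub>v v"
      using orthogonal_mat_extending_vec[OF v] .
    have WW': "W * W\<^sup>T = 1\<^sub>m ?n"
      using mat_mult_left_right_inverse[OF _ W WW] W by simp
    define B where "B = W\<^sup>T * A * W"
    have B: "B \<in> carrier_mat ?n ?n" using A W by (simp add: B_def)
    have "B\<^sup>T = W\<^sup>T * (A * W)"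
      using A W Suc.prems(2)
      by (simp add: B_def transpose_mult[of _ ?n ?n _ ?n])
    then have BT: "B\<^sup>T = B"
      using A W by (simp add: B_def assoc_mult_mat[of _ ?n ?n _ ?n _ ?n])
    \<comment> \<open>Entry \<open>(i, 0)\<close> of \<open>B\<close> is \<open>e\<close> times the
      inner product of columns \<open>i\<close> and 0 of \<open>W\<close>, which are orthonormal.
      Symmetry of \<open>B\<close> then clears the first row as well.\<close>
    have B0: "B $$ (i, 0) = (if i = 0 then e else 0)" if i: "i < ?n" for i
    proof -
      have "B $$ (i, 0) = (W\<^sup>T * (A * W)) $$ (i, 0)"
        using A W by (simp add: B_def assoc_mult_mat[of _ ?n ?n _ ?n _ ?n])
      also have "\<dots> = col W i \<bullet> (A *\<^sub>v col W 0)"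
        using A W i by (simp add: mult_mat_vec_def)
      also have "A *\<^sub>v col W 0 = e \<cdot>\<^sub>v col W 0"
        using A v by (simp add: W0 mult_mat_vec Av smult_smult_assoc mult.commute)
      also have "col W i \<bullet> (e \<cdot>\<^sub>v col W 0) = e * (W\<^sup>T * W) $$ (i, 0)"
        using W i by simp
      finally show ?thesis using i by (simp add: WW)
    qed
    have B0': "B $$ (0, i) = (if i = 0 then e else 0)" if i: "i < ?n" for i
      using B0[OF that] B i arg_cong[OF BT, of "\<lambda>M. M $$ (i, 0)"] by simp
    define A3 where "A3 = mat m m (\<lambda>(i, j). B $$ (Suc i, Suc j))"
    have A3: "A3 \<in> carrier_mat m m" by (simp add: A3_def)
    have "A3\<^sup>T = A3"
    proof (rule eq_matI)
      fix i j assume "i < dim_row A3" "j < dim_col A3"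
      then show "A3\<^sup>T $$ (i, j) = A3 $$ (i, j)"
        using B arg_cong[OF BT, of "\<lambda>M. M $$ (Suc i, Suc j)"] by (simp add: A3_def)
    qed (auto simp: A3_def)
    from Suc.IH[OF A3 this] obtain U3 d where U3: "U3 \<in> carrier_mat m m"
      and UU3: "U3\<^sup>T * U3 = 1\<^sub>m m" and A3_eq: "A3 = U3 * mat_diag m d * U3\<^sup>T" by blast
    \<comment> \<open>\<open>F\<close> leaves the split-off coordinate alone and diagonalizes the
      remaining block, so the new eigenvalue \<open>e\<close> goes in front of the list
      \<open>d\<close>.\<close>
    define F where "F = four_block_mat (1\<^sub>m 1) (0\<^sub>m 1 m) (0\<^sub>m m 1) U3"
    define d' where "d' = case_nat e d"
    have F: "F \<in> carrier_mat ?n ?n"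
      using four_block_carrier_mat[OF one_carrier_mat U3, of 1] by (simp add: F_def)
    have FT: "F\<^sup>T = four_block_mat (1\<^sub>m 1) (0\<^sub>m 1 m) (0\<^sub>m m 1) U3\<^sup>T"
      unfolding F_def by (subst transpose_four_block_mat[of _ 1 1 _ m _ m]) (use U3 in auto)
    have FF: "F\<^sup>T * F = 1\<^sub>m ?n"
      unfolding FT unfolding F_def
      by (subst mult_four_block_mat[of _ 1 1 _ m _ m _ _ 1 _ m])
        (use U3 UU3 four_block_one_mat[of 1 m] in auto)
    have D_eq: "mat_diag ?n d' = four_block_mat (mat 1 1 (\<lambda>_. e)) (0\<^sub>m 1 m) (0\<^sub>m m 1) (mat_diag m d)"
      by (rule eq_matI) (auto simp: d'_def mat_diag_def split: nat.splits)
    have md: "mat_diag m d \<in> carrier_mat m m" by simp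
    have fb: "four_block_mat (mat 1 1 (\<lambda>_. e)) (0\<^sub>m 1 m) (0\<^sub>m m 1) A3 = B"
      using B by (intro eq_matI) (auto simp: A3_def B0 B0' less_Suc_eq_0_disj)
    have "F * mat_diag ?n d' = four_block_mat (mat 1 1 (\<lambda>_. e)) (0\<^sub>m 1 m) (0\<^sub>m m 1) (U3 * mat_diag m d)"
      unfolding D_eq F_def
      by (subst mult_four_block_mat[of _ 1 1 _ m _ m _ _ 1 _ m])
        (use U3 in \<open>auto simp: left_mult_zero_mat[OF md]\<close>)
    moreover have "U3 * mat_diag m d * U3\<^sup>T \<in> carrier_mat m m" using U3 by auto
    ultimately have FDF: "F * mat_diag ?n d' * F\<^sup>T = B"
      unfolding FT fb[symmetric] A3_eq
      by (simp, subst mult_four_block_mat[of _ 1 1 _ m _ m _ _ 1 _ m])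
        (use U3 in \<open>auto simp: right_mult_zero_mat[OF mult_carrier_mat[OF U3 md]]\<close>)
    define U where "U = W * F"
    have U: "U \<in> carrier_mat ?n ?n" using W F by (simp add: U_def)
    have UT: "U\<^sup>T = F\<^sup>T * W\<^sup>T" using W F by (simp add: U_def transpose_mult)
    have "U\<^sup>T * U = F\<^sup>T * (W\<^sup>T * W) * F"
      unfolding UT unfolding U_def using W F by (simp add: assoc_mult_mat[of _ ?n ?n _ ?n _ ?n])
    also have "\<dots> = 1\<^sub>m ?n" using F FF by (simp add: WW)
    finally have UU: "U\<^sup>T * U = 1\<^sub>m ?n" .
    define D where "D = mat_diag ?n d'"
    have D_carrier: "D \<in> carrier_mat ?n ?n" by (simp add: D_def)
    have "U * D * U\<^sup>T = W * (F * D * F\<^sup>T) * W\<^sup>T"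
      unfolding UT unfolding U_def using W F D_carrier by (simp add: assoc_mult_mat[of _ ?n ?n _ ?n _ ?n])
    also have "\<dots> = (W * W\<^sup>T) * A * (W * W\<^sup>T)"
      unfolding D_def FDF B_def using W A by (simp add: assoc_mult_mat[of _ ?n ?n _ ?n _ ?n])
    also have "\<dots> = A" using A by (simp add: WW')
    finally show ?case using U UU unfolding D_def by metis
  qed
  then show thesis using that by blast
qed

section \<open>Eigenvalue multiplicities read off from a diagonalization\<close>

lemma char_poly_diagonalization:
  fixes A :: "real mat"
  assumes U: "U \<in> carrier_mat n n" and UU: "U\<^sup>T * U = 1\<^sub>m n"
    and A: "A = U * mat_diag n d * U\<^sup>T"
  shows "char_poly A = (\<Prod>i<n. [:- d i, 1:])"
proof -
  have "U * U\<^sup>T = 1\<^sub>m n"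
    using mat_mult_left_right_inverse[OF _ U UU] U by simp
  then have "similar_mat_wit A (mat_diag n d) U (U\<^sup>T)"
    using U UU A by (intro similar_mat_witI[of _ _ n]) auto
  then have "char_poly A = char_poly (mat_diag n d)"
    by (intro char_poly_similar) (auto simp: similar_mat_def)
  also have "\<dots> = (\<Prod>a\<leftarrow>diag_mat (mat_diag n d). [:- a, 1:])"
    by (rule char_poly_upper_triangular[of _ n]) (auto simp: mat_diag_def)
  also have "diag_mat (mat_diag n d) = map d [0..<n]"
    by (auto simp: diag_mat_def mat_diag_def)
  also have "(\<Prod>a\<leftarrow>map d [0..<n]. [:- a, 1:]) = (\<Prod>i<n. [:- d i, 1:])"
    by (simp add: comp_def atLeast0LessThan flip: prod.distinct_set_conv_list)
  finally show ?thesis .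
qed

lemma order_prod_linear_factors:
  fixes d :: "'b \<Rightarrow> 'a :: field"
  assumes "finite S"
  shows "order x (\<Prod>i\<in>S. [:- d i, 1:]) = card {i \<in> S. d i = x}"
  using assms
proof induction
  case (insert a S)
  have nz: "(\<Prod>i\<in>S. [:- d i, 1:]) \<noteq> 0" using insert.hyps by simp
  have 1: "order x [:- d a, 1:] = (if d a = x then 1 else 0)"
    using order_power_n_n[of x 1] by (auto intro: order_0I)
  have "{i \<in> insert a S. d i = x} = (if d a = x then insert a {i \<in> S. d i = x} else {i \<in> S. d i = x})"
    by auto
  then show ?case using insert nz 1
    by (simp add: order_mult del: mult_pCons_left)
qed simp

text \<open>Group the indices by the value of \<open>d\<close>: each root \<open>x\<close> is hit by
  exactly as many indices as its order. This turns the sums over distinct eigenvalues in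
  \<open>s_plus\<close> and \<open>s_minus\<close> into sums over a list of eigenvalues with
  repetition.\<close>

lemma sum_roots_with_order:
  fixes f :: "real \<Rightarrow> real"
  assumes "finite S" and p: "p = (\<Prod>i\<in>S. [:- d i, 1:])"
  shows "(\<Sum>x | poly p x = 0 \<and> Q x. real (order x p) * f x) = (\<Sum>i\<in>S. if Q (d i) then f (d i) else 0)"
proof -
  have "(\<Sum>i\<in>S. if Q (d i) then f (d i) else 0) = (\<Sum>i\<in>{i\<in>S. Q (d i)}. f (d i))"
    using assms(1) by (simp add: sum.inter_filter)
  also have "\<dots> = (\<Sum>x\<in>d ` {i\<in>S. Q (d i)}. \<Sum>i\<in>{i \<in> {i\<in>S. Q (d i)}. d i = x}. f (d i))"
    using assms(1) by (intro sum.image_gen) simp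
  also have "\<dots> = (\<Sum>x | poly p x = 0 \<and> Q x. real (order x p) * f x)"
  proof (rule sum.cong)
    show "d ` {i \<in> S. Q (d i)} = {x. poly p x = 0 \<and> Q x}"
      using assms by (auto simp: poly_prod)
    fix x assume "x \<in> {x. poly p x = 0 \<and> Q x}"
    then have "{i \<in> {i\<in>S. Q (d i)}. d i = x} = {i \<in> S. d i = x}" by auto
    then show "(\<Sum>i\<in>{i \<in> {i\<in>S. Q (d i)}. d i = x}. f (d i)) = real (order x p) * f x"
      using assms by (simp add: order_prod_linear_factors)
  qed
  finally show ?thesis by simp
qed

section \<open>Positive semidefinite parts\<close>

text \<open>A weighted Gram representation instead of nonnegativity of the quadratic form:
  diagonalization supplies it directly, and it makes trace inequalities immediate. For infinite
  \<open>K\<close> the sum defaults to 0, so the predicate still describes only positive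
  semidefinite matrices.\<close>

definition psd_on :: "'i set \<Rightarrow> ('i \<Rightarrow> 'i \<Rightarrow> real) \<Rightarrow> bool" where
  "psd_on I P \<longleftrightarrow> (\<exists>(K :: nat set) c u. (\<forall>k\<in>K. c k \<ge> 0) \<and>
     (\<forall>i\<in>I. \<forall>j\<in>I. P i j = (\<Sum>k\<in>K. c k * (u i k * u j k))))"

text \<open>By bilinearity this reduces to rank-one matrices: the entrywise inner product of the
  outer squares of two vectors is the square of the inner product of the vectors.\<close>

lemma sum_weighted_gram_mult:
  fixes c d :: "'k \<Rightarrow> real"
  shows "(\<Sum>i\<in>I. \<Sum>j\<in>I. (\<Sum>k\<in>K. c k * (u i k * u j k)) * (\<Sum>l\<in>L. d l * (v i l * v j l)))
       = (\<Sum>k\<in>K. \<Sum>l\<in>L. c k * d l * (\<Sum>i\<in>I. u i k * v i l)\<^sup>2)"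
proof -
  have "(\<Sum>i\<in>I. \<Sum>j\<in>I. (\<Sum>k\<in>K. c k * (u i k * u j k)) * (\<Sum>l\<in>L. d l * (v i l * v j l)))
      = (\<Sum>i\<in>I. \<Sum>j\<in>I. \<Sum>k\<in>K. \<Sum>l\<in>L. c k * d l * ((u i k * v i l) * (u j k * v j l)))"
    by (simp add: sum_product mult_ac)
  also have "\<dots> = (\<Sum>i\<in>I. \<Sum>k\<in>K. \<Sum>j\<in>I. \<Sum>l\<in>L. c k * d l * ((u i k * v i l) * (u j k * v j l)))"
    by (intro sum.cong refl sum.swap)
  also have "\<dots> = (\<Sum>k\<in>K. \<Sum>i\<in>I. \<Sum>l\<in>L. \<Sum>j\<in>I. c k * d l * ((u i k * v i l) * (u j k * v j l)))"
    by (subst sum.swap) (intro sum.cong refl sum.swap)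
  also have "\<dots> = (\<Sum>k\<in>K. \<Sum>l\<in>L. \<Sum>i\<in>I. \<Sum>j\<in>I. c k * d l * ((u i k * v i l) * (u j k * v j l)))"
    by (intro sum.cong refl sum.swap)
  also have "\<dots> = (\<Sum>k\<in>K. \<Sum>l\<in>L. c k * d l * (\<Sum>i\<in>I. u i k * v i l)\<^sup>2)"
    unfolding power2_eq_square sum_product by (simp add: sum_distrib_left)
  finally show ?thesis .
qed

lemma sum_psd_on_mult_nonneg:
  assumes "psd_on I P" "psd_on I Q"
  shows "(\<Sum>i\<in>I. \<Sum>j\<in>I. P i j * Q i j) \<ge> 0"
proof -
  obtain K :: "nat set" and c u where c: "\<forall>k\<in>K. c k \<ge> 0"
    and P: "\<forall>i\<in>I. \<forall>j\<in>I. P i j = (\<Sum>k\<in>K. c k * (u i k * u j k))"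
    using assms(1) by (auto simp: psd_on_def)
  obtain L :: "nat set" and d v where d: "\<forall>k\<in>L. d k \<ge> 0"
    and Q: "\<forall>i\<in>I. \<forall>j\<in>I. Q i j = (\<Sum>k\<in>L. d k * (v i k * v j k))"
    using assms(2) by (auto simp: psd_on_def)
  have "(\<Sum>i\<in>I. \<Sum>j\<in>I. P i j * Q i j)
      = (\<Sum>i\<in>I. \<Sum>j\<in>I. (\<Sum>k\<in>K. c k * (u i k * u j k)) * (\<Sum>l\<in>L. d l * (v i l * v j l)))"
    using P Q by simp
  also have "\<dots> \<ge> 0"
    unfolding sum_weighted_gram_mult using c d by (intro sum_nonneg mult_nonneg_nonneg) auto
  finally show ?thesis .
qed

text \<open>Pairing a positive semidefinite matrix with this rank-one matrix shows that its entries
  have nonnegative sum.\<close>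

lemma psd_on_one: "psd_on I (\<lambda>_ _. 1)"
  unfolding psd_on_def by (intro exI[of _ "{0}"] exI[of _ "\<lambda>_. 1"] exI[of _ "\<lambda>_ _. 1"]) simp

lemma symmetric_real_mat_psd_split:
  fixes A :: "real mat"
  assumes A: "A \<in> carrier_mat n n" and sym: "A\<^sup>T = A"
  obtains P N where "psd_on {..<n} P" "psd_on {..<n} N"
    "\<And>i j. i < n \<Longrightarrow> j < n \<Longrightarrow> A $$ (i, j) = P i j - N i j"
    "(\<Sum>i<n. \<Sum>j<n. (P i j)\<^sup>2) = (\<Sum>x | poly (char_poly A) x = 0 \<and> x > 0. real (order x (char_poly A)) * x\<^sup>2)"
    "(\<Sum>i<n. \<Sum>j<n. (N i j)\<^sup>2) = (\<Sum>x | poly (char_poly A) x = 0 \<and> x < 0. real (order x (char_poly A)) * x\<^sup>2)"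
    "(\<Sum>i<n. \<Sum>j<n. (P i j)\<^sup>2) + (\<Sum>i<n. \<Sum>j<n. (N i j)\<^sup>2) = (\<Sum>i<n. \<Sum>j<n. (A $$ (i, j))\<^sup>2)"
proof -
  obtain U d where U: "U \<in> carrier_mat n n" and UU: "U\<^sup>T * U = 1\<^sub>m n"
    and Ad: "A = U * mat_diag n d * U\<^sup>T"
    using symmetric_real_mat_diagonalization[OF A sym] .
  define u where "u i k = U $$ (i, k)" for i k
  define F where "F c i j = (\<Sum>k<n. c k * (u i k * u j k))" for c :: "nat \<Rightarrow> real" and i j
  have orth: "(\<Sum>i<n. u i k * u i l) = (if k = l then 1 else 0)" if "k < n" "l < n" for k l
    using arg_cong[OF UU, of "\<lambda>M. M $$ (k, l)"] that U
    by (simp add: u_def scalar_prod_def atLeast0LessThan)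
  \<comment> \<open>The columns of \<open>U\<close> are orthonormal, so in the double sum over pairs
    of columns only the diagonal terms survive.\<close>
  have norm: "(\<Sum>i<n. \<Sum>j<n. (F c i j)\<^sup>2) = (\<Sum>k<n. (c k)\<^sup>2)" for c
  proof -
    have "(\<Sum>i<n. \<Sum>j<n. (F c i j)\<^sup>2) = (\<Sum>k<n. \<Sum>l<n. c k * c l * (\<Sum>i<n. u i k * u i l)\<^sup>2)"
      unfolding F_def power2_eq_square[of "sum _ {..<n}" for n]
      by (simp add: sum_weighted_gram_mult power2_eq_square)
    also have "\<dots> = (\<Sum>k<n. \<Sum>l<n. if k = l then c k * c l else 0)"
      by (intro sum.cong refl) (simp add: orth)
    also have "\<dots> = (\<Sum>k<n. (c k)\<^sup>2)" by (simp add: power2_eq_square)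
    finally show ?thesis .
  qed
  have psd: "psd_on {..<n} (F c)" if "\<And>k. c k \<ge> 0" for c
    unfolding psd_on_def F_def using that by blast
  have AF: "A $$ (i, j) = F d i j" if "i < n" "j < n" for i j
  proof -
    define M where "M = U * mat_diag n d"
    have "M \<in> carrier_mat n n" using U by (simp add: M_def)
    then have "A $$ (i, j) = (\<Sum>k<n. M $$ (i, k) * u j k)"
      using that U unfolding Ad M_def[symmetric]
      by (simp add: u_def scalar_prod_def atLeast0LessThan)
    also have "\<dots> = F d i j"
      unfolding F_def M_def
      by (intro sum.cong refl) (use that U in \<open>simp add: mat_diag_mult_right[OF U] u_def\<close>)
    finally show ?thesis .
  qed
  \<comment> \<open>\<open>P\<close> keeps the positive eigenvalues and \<open>N\<close> the
    absolute values of the negative ones, on the same eigenvectors. At most one of the two weights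
    is nonzero for each \<open>k\<close>, which makes the squared norms add up.\<close>
  define P where "P = F (\<lambda>k. max (d k) 0)"
  define N where "N = F (\<lambda>k. max (- d k) 0)"
  note cp = char_poly_diagonalization[OF U UU Ad]
  note roots = sum_roots_with_order[OF finite_lessThan cp, where f = "\<lambda>x. x\<^sup>2"]
  show thesis
  proof (rule that[of P N])
    show "psd_on {..<n} P" "psd_on {..<n} N" unfolding P_def N_def by (auto intro: psd)
    show "A $$ (i, j) = P i j - N i j" if "i < n" "j < n" for i j
      unfolding AF[OF that] P_def N_def F_def sum_subtractf[symmetric]
      by (intro sum.cong refl) (auto simp: max_def)
    show "(\<Sum>i<n. \<Sum>j<n. (P i j)\<^sup>2) = (\<Sum>x | poly (char_poly A) x = 0 \<and> x > 0. real (order x (char_poly A)) * x\<^sup>2)"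
      unfolding P_def norm roots[of "\<lambda>x. 0 < x"] by (intro sum.cong) (auto simp: max_def)
    show "(\<Sum>i<n. \<Sum>j<n. (N i j)\<^sup>2) = (\<Sum>x | poly (char_poly A) x = 0 \<and> x < 0. real (order x (char_poly A)) * x\<^sup>2)"
      unfolding N_def norm roots[of "\<lambda>x. x < 0"] by (intro sum.cong) (auto simp: max_def)
    have "(\<Sum>i<n. \<Sum>j<n. (A $$ (i, j))\<^sup>2) = (\<Sum>i<n. \<Sum>j<n. (F d i j)\<^sup>2)"
      by (simp add: AF)
    moreover have "(\<Sum>k<n. (max (d k) 0)\<^sup>2) + (\<Sum>k<n. (max (- d k) 0)\<^sup>2) = (\<Sum>k<n. (d k)\<^sup>2)"
      unfolding sum.distrib[symmetric] by (intro sum.cong) (auto simp: max_def)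
    ultimately show "(\<Sum>i<n. \<Sum>j<n. (P i j)\<^sup>2) + (\<Sum>i<n. \<Sum>j<n. (N i j)\<^sup>2) = (\<Sum>i<n. \<Sum>j<n. (A $$ (i, j))\<^sup>2)"
      unfolding P_def N_def norm by simp
  qed
qed

section \<open>The strict lower bound in matrix form\<close>

lemma sum_psd_positive_parts_gt:
  fixes P Q N M :: "nat \<Rightarrow> nat \<Rightarrow> real"
  assumes n: "n \<ge> 2"
    and P: "psd_on {..<n} P" and Q: "psd_on {..<n} Q"
    and N: "psd_on {..<n} N" and M: "psd_on {..<n} M"
    and J: "\<And>i j. i < n \<Longrightarrow> j < n \<Longrightarrow> (P i j - N i j) + (Q i j - M i j) = (if i = j then 0 else 1)"
    and total: "(\<Sum>i<n. \<Sum>j<n. (P i j)\<^sup>2) + (\<Sum>i<n. \<Sum>j<n. (Q i j)\<^sup>2) +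
      ((\<Sum>i<n. \<Sum>j<n. (N i j)\<^sup>2) + (\<Sum>i<n. \<Sum>j<n. (M i j)\<^sup>2)) = real n * (real n - 1)"
  shows "(real n - 1)\<^sup>2 / 2 < (\<Sum>i<n. \<Sum>j<n. (P i j)\<^sup>2) + (\<Sum>i<n. \<Sum>j<n. (Q i j)\<^sup>2)"
proof (rule ccontr)
  define S where "S f = (\<Sum>i<n. \<Sum>j<n. f i j)" for f :: "nat \<Rightarrow> nat \<Rightarrow> real"
  define p where "p = (\<Sum>i<n. \<Sum>j<n. (P i j)\<^sup>2) + (\<Sum>i<n. \<Sum>j<n. (Q i j)\<^sup>2)"
  define X where "X i j = P i j + Q i j" for i j
  define Y where "Y i j = N i j + M i j" for i j
  \<comment> \<open>The mean entry of \<open>X\<close> when its entries sum to exactly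
    \<open>n * (n - 1)\<close>, hence the value of every entry in the equality case.\<close>
  define c where "c = (real n - 1) / real n"
  assume "\<not> ?thesis"
  then have p: "p \<le> (real n - 1)\<^sup>2 / 2" by (simp add: p_def)
  have n0: "real n > 0" using n by simp
  have diag: "S (\<lambda>i j. if i = j then x else y) = real n * x + real n * (real n - 1) * y" for x y
  proof -
    have "S (\<lambda>i j. if i = j then x else y) = S (\<lambda>i j. y + (if i = j then x - y else 0))"
      unfolding S_def by (intro sum.cong) auto
    also have "\<dots> = real n * (real n * y) + real n * (x - y)"
      by (simp add: S_def sum.distrib algebra_simps)
    finally show ?thesis by (simp add: algebra_simps)
  qed
  have "0 \<le> S N" "0 \<le> S M"
    using sum_psd_on_mult_nonneg[OF N psd_on_one] sum_psd_on_mult_nonneg[OF M psd_on_one]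
    by (auto simp: S_def)
  moreover have "S X - (S N + S M) = S (\<lambda>i j. if i = j then 0 else 1)"
    unfolding S_def X_def sum.distrib[symmetric] sum_subtractf[symmetric]
    by (intro sum.cong refl) (simp flip: J)
  ultimately have SX: "S X \<ge> real n * (real n - 1)"
    unfolding diag by simp
  have "S (\<lambda>i j. (X i j)\<^sup>2) \<le> S (\<lambda>i j. 2 * (P i j)\<^sup>2 + 2 * (Q i j)\<^sup>2)"
    unfolding S_def X_def
  proof (intro sum_mono)
    fix i j
    show "(P i j + Q i j)\<^sup>2 \<le> 2 * (P i j)\<^sup>2 + 2 * (Q i j)\<^sup>2"
      using zero_le_power2[of "P i j - Q i j"] by (simp add: power2_sum power2_diff)
  qed
  also have "\<dots> = 2 * p"
    by (simp add: S_def p_def sum.distrib sum_distrib_left)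
  finally have SX2: "S (\<lambda>i j. (X i j)\<^sup>2) \<le> (real n - 1)\<^sup>2"
    using p by simp
  \<comment> \<open>Expanding the squared distance of \<open>X\<close> to the constant matrix
    replaces the equality case of Cauchy-Schwarz. As \<open>c\<close> is nonnegative, the lower
    bound on \<open>S X\<close> bounds this distance above by 0.\<close>
  have "S (\<lambda>i j. (X i j - c)\<^sup>2) = S (\<lambda>i j. (X i j)\<^sup>2) - 2 * c * S X + real n * real n * c\<^sup>2"
    by (simp add: S_def power2_diff sum.distrib sum_subtractf sum_distrib_left mult_ac)
  also have "\<dots> \<le> (real n - 1)\<^sup>2 - 2 * c * (real n * (real n - 1)) + real n * real n * c\<^sup>2"
    using SX2 SX n by (intro add_mono diff_mono mult_left_mono) (auto simp: c_def)
  also have "\<dots> = 0"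
    using n0 by (simp add: c_def field_simps power2_eq_square)
  finally have "S (\<lambda>i j. (X i j - c)\<^sup>2) \<le> 0" .
  moreover have "S (\<lambda>i j. (X i j - c)\<^sup>2) \<ge> 0"
    unfolding S_def by (intro sum_nonneg) auto
  ultimately have "S (\<lambda>i j. (X i j - c)\<^sup>2) = 0" by simp
  then have X: "X i j = c" if "i < n" "j < n" for i j
    using that by (simp add: S_def sum_nonneg_eq_0_iff sum_nonneg)
  have Y: "Y i j = (if i = j then c else c - 1)" if "i < n" "j < n" for i j
    using J[OF that] X[OF that] by (auto simp: X_def Y_def split: if_splits)
  have "S (\<lambda>i j. (Y i j)\<^sup>2) = S (\<lambda>i j. if i = j then c\<^sup>2 else (c - 1)\<^sup>2)"
    unfolding S_def by (intro sum.cong refl) (auto simp: Y)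
  also have "\<dots> = real n - 1"
    unfolding diag using n0 by (simp add: c_def field_simps power2_eq_square)
  finally have SY: "S (\<lambda>i j. (Y i j)\<^sup>2) = real n - 1" .
  \<comment> \<open>The cross term is an entrywise inner product of two positive semidefinite
    matrices, hence nonnegative.\<close>
  have "S (\<lambda>i j. (Y i j)\<^sup>2) = S (\<lambda>i j. (N i j)\<^sup>2) + S (\<lambda>i j. (M i j)\<^sup>2) + 2 * S (\<lambda>i j. N i j * M i j)"
    by (simp add: S_def Y_def power2_sum sum.distrib sum_distrib_left mult_ac)
  also have "\<dots> \<ge> S (\<lambda>i j. (N i j)\<^sup>2) + S (\<lambda>i j. (M i j)\<^sup>2)"
    using sum_psd_on_mult_nonneg[OF N M] by (simp add: S_def)
  finally have "real n * (real n - 1) - p \<le> real n - 1"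
    using SY total by (simp add: S_def p_def)
  \<comment> \<open>The previous line says that \<open>p\<close> is at least the square of
    \<open>n - 1\<close>, while \<open>p\<close> is assumed to be at most half of that; for
    \<open>n\<close> at least 2 this is absurd.\<close>
  with p have "(real n - 1) * (real n - 1) \<le> (real n - 1) * ((real n - 1) / 2)"
    by (simp add: power2_eq_square algebra_simps)
  then show False using n by simp
qed

section \<open>Graphs and their complements\<close>

text \<open>If the complement is disconnected, let \<open>C\<close> be the component of
  \<open>u\<close> in it. Then \<open>G\<close> contains every edge between \<open>C\<close> and the
  rest, and both sides are nonempty.\<close>

lemma connected_or_complement_connected:
  assumes G: "pair_graph G" and ne: "pverts G \<noteq> {}"
  shows "Digraph_Component.connected (with_proj G) \<or>
    Digraph_Component.connected (with_proj (graph_complement G))"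
proof (rule disjCI)
  define R where "R = rtrancl_on (pverts G) (symcl (parcs G))"
  define R' where "R' = rtrancl_on (pverts G) (symcl (parcs (graph_complement G)))"
  assume "\<not> Digraph_Component.connected (with_proj (graph_complement G))"
  then obtain u v where u: "u \<in> pverts G" and v: "v \<in> pverts G" and uv: "(u, v) \<notin> R'"
    using ne by (auto simp: connected_conv R'_def graph_complement_def)
  define C where "C = {w \<in> pverts G. (u, w) \<in> R'}"
  \<comment> \<open>An edge of the complement from \<open>a\<close> to \<open>b\<close> would make
    \<open>b\<close> reachable from \<open>u\<close> and put it into \<open>C\<close>.\<close>
  have cross: "(a, b) \<in> R \<and> (b, a) \<in> R"
    if "a \<in> C" "b \<in> pverts G - C" for a b
  proof -
    have "(a, b) \<notin> symcl (parcs (graph_complement G))"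
      using that rtrancl_on_into_rtrancl_on[of u a "pverts G" _ b] by (auto simp: C_def R'_def)
    then have "(a, b) \<in> symcl (parcs G)" "(b, a) \<in> symcl (parcs G)"
      using that by (auto simp: symcl_def graph_complement_def C_def image_iff)
    then show ?thesis
      using that by (auto simp: R_def C_def intro: rtrancl_on_into_rtrancl_on)
  qed
  have uC: "u \<in> C" and vC: "v \<in> pverts G - C"
    using u v uv by (auto simp: C_def R'_def)
  have "(a, b) \<in> R" if "a \<in> pverts G" "b \<in> pverts G" for a b
  proof -
    \<comment> \<open>A vertex of \<open>C\<close> reaches \<open>u\<close> by a detour through
      \<open>v\<close> on the other side; a vertex outside \<open>C\<close> is adjacent to
      \<open>u\<close>.\<close>
    have "(a, u) \<in> R" if "a \<in> pverts G" for a
    proof (cases "a \<in> C")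
      case True
      then show ?thesis using cross[OF True vC] cross[OF uC vC]
        unfolding R_def by (blast intro: rtrancl_on_trans)
    next
      case False
      then show ?thesis using cross[OF uC] that by blast
    qed
    moreover have "(u, b) \<in> R" if "b \<in> pverts G" for b
    proof (cases "b \<in> C")
      case True
      then show ?thesis using cross[OF True vC] cross[OF uC vC]
        unfolding R_def by (blast intro: rtrancl_on_trans)
    next
      case False
      then show ?thesis using cross[OF uC] that by blast
    qed
    ultimately show ?thesis using that unfolding R_def by (blast intro: rtrancl_on_trans)
  qed
  then show "Digraph_Component.connected (with_proj G)"
    using ne by (simp add: connected_conv R_def)
qed

section \<open>Spectral sums of a graph and of its complement\<close>

lemma
  assumes "distinct vs" "set vs = pverts G"
  shows s_plus_eq_char_poly_adj_mat_list: "s_plus G = (\<Sum>x | poly (char_poly (adj_mat_list G vs)) x = 0 \<and> x > 0.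
      real (order x (char_poly (adj_mat_list G vs))) * x\<^sup>2)"
    and s_minus_eq_char_poly_adj_mat_list: "s_minus G = (\<Sum>x | poly (char_poly (adj_mat_list G vs)) x = 0 \<and> x < 0.
      real (order x (char_poly (adj_mat_list G vs))) * x\<^sup>2)"
proof -
  define ws where "ws = (SOME vs. distinct vs \<and> set vs = pverts G)"
  have ws: "distinct ws \<and> set ws = pverts G"
    unfolding ws_def by (rule someI[of _ vs]) (use assms in blast)
  have adj: "adj_mat G = adj_mat_list G ws" by (simp add: adj_mat_def ws_def)
  have cp: "char_poly (adj_mat G) = char_poly (adj_mat_list G vs)"
    unfolding adj using ws assms by (intro char_poly_adj_mat_list) auto
  have "adj_mat G \<in> carrier_mat (length ws) (length ws)"
    by (simp add: adj adj_mat_list_def)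
  note ev = eigenvalue_root_char_poly[OF this, unfolded cp]
  show "s_plus G = (\<Sum>x | poly (char_poly (adj_mat_list G vs)) x = 0 \<and> x > 0.
      real (order x (char_poly (adj_mat_list G vs))) * x\<^sup>2)"
    by (simp add: s_plus_def ev cp)
  show "s_minus G = (\<Sum>x | poly (char_poly (adj_mat_list G vs)) x = 0 \<and> x < 0.
      real (order x (char_poly (adj_mat_list G vs))) * x\<^sup>2)"
    by (simp add: s_minus_def ev cp)
qed

lemma s_minus_nonneg: "s_minus G \<ge> 0"
  unfolding s_minus_def by (intro sum_nonneg) auto

lemma adjacency_psd_split:
  assumes G: "pair_graph G" and vs: "distinct vs" "set vs = pverts G"
  defines "n \<equiv> length vs"
  obtains P N where "psd_on {..<n} P" "psd_on {..<n} N"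
    "\<And>i j. i < n \<Longrightarrow> j < n \<Longrightarrow> P i j - N i j = of_bool ((vs ! i, vs ! j) \<in> parcs G)"
    "(\<Sum>i<n. \<Sum>j<n. (P i j)\<^sup>2) = s_plus G" "(\<Sum>i<n. \<Sum>j<n. (N i j)\<^sup>2) = s_minus G"
    "s_plus G + s_minus G = (\<Sum>i<n. \<Sum>j<n. of_bool ((vs ! i, vs ! j) \<in> parcs G))"
proof -
  interpret pair_graph G by fact
  define A where "A = adj_mat_list G vs"
  have A: "A \<in> carrier_mat n n" by (simp add: A_def adj_mat_list_def n_def)
  have A_eq: "A $$ (i, j) = of_bool ((vs ! i, vs ! j) \<in> parcs G)" if "i < n" "j < n" for i j
    using that by (simp add: A_def adj_mat_list_def n_def)
  have "sym (parcs G)" using pair_sym_arcs by (simp add: symmetric_def)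
  then have "A\<^sup>T = A"
    using A by (intro eq_matI) (auto simp: A_eq dest: symD)
  note split = symmetric_real_mat_psd_split[OF A this, folded
      s_plus_eq_char_poly_adj_mat_list[OF vs, folded A_def]
      s_minus_eq_char_poly_adj_mat_list[OF vs, folded A_def]]
  obtain P N where
    "psd_on {..<n} P" "psd_on {..<n} N"
    and AE: "\<And>i j. i < n \<Longrightarrow> j < n \<Longrightarrow> A $$ (i, j) = P i j - N i j"
    and PN: "(\<Sum>i<n. \<Sum>j<n. (P i j)\<^sup>2) = s_plus G" "(\<Sum>i<n. \<Sum>j<n. (N i j)\<^sup>2) = s_minus G"
    and "(\<Sum>i<n. \<Sum>j<n. (P i j)\<^sup>2) + (\<Sum>i<n. \<Sum>j<n. (N i j)\<^sup>2) = (\<Sum>i<n. \<Sum>j<n. (A $$ (i, j))\<^sup>2)"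
    by (rule split) (rule that)
  \<comment> \<open>The entries are 0 or 1, so squaring leaves them unchanged and the squared norm
    counts the arcs.\<close>
  moreover have "(\<Sum>i<n. \<Sum>j<n. (A $$ (i, j))\<^sup>2) = (\<Sum>i<n. \<Sum>j<n. of_bool ((vs ! i, vs ! j) \<in> parcs G))"
    by (intro sum.cong refl) (simp add: A_eq power2_eq_square)
  ultimately show thesis
    using that[of P N] by (simp flip: A_eq)
qed

lemma
  assumes G: "pair_graph G" and n: "card (pverts G) = n"
  shows s_total_complement: "s_plus G + s_minus G + (s_plus (graph_complement G) + s_minus (graph_complement G)) =
      real n * (real n - 1)" (is ?total)
    and s_plus_complement_gt: "n \<ge> 2 \<Longrightarrow> (real n - 1)\<^sup>2 / 2 < s_plus G + s_plus (graph_complement G)"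
proof -
  let ?H = "graph_complement G"
  interpret pair_graph G by fact
  obtain vs where vs: "distinct vs" "set vs = pverts G"
    using finite_distinct_list[of "pverts G"] by auto
  have len: "length vs = n" using distinct_card[OF vs(1)] vs(2) n by simp
  have vs': "set vs = pverts ?H" using vs by (simp add: graph_complement_def)
  obtain P N where PN: "psd_on {..<n} P" "psd_on {..<n} N"
    "\<And>i j. i < n \<Longrightarrow> j < n \<Longrightarrow> P i j - N i j = of_bool ((vs ! i, vs ! j) \<in> parcs G)"
    "(\<Sum>i<n. \<Sum>j<n. (P i j)\<^sup>2) = s_plus G" "(\<Sum>i<n. \<Sum>j<n. (N i j)\<^sup>2) = s_minus G"
    "s_plus G + s_minus G = (\<Sum>i<n. \<Sum>j<n. of_bool ((vs ! i, vs ! j) \<in> parcs G))"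
    by (rule adjacency_psd_split[OF G vs, unfolded len]) (rule that)
  obtain Q M where QM: "psd_on {..<n} Q" "psd_on {..<n} M"
    "\<And>i j. i < n \<Longrightarrow> j < n \<Longrightarrow> Q i j - M i j = of_bool ((vs ! i, vs ! j) \<in> parcs ?H)"
    "(\<Sum>i<n. \<Sum>j<n. (Q i j)\<^sup>2) = s_plus ?H" "(\<Sum>i<n. \<Sum>j<n. (M i j)\<^sup>2) = s_minus ?H"
    "s_plus ?H + s_minus ?H = (\<Sum>i<n. \<Sum>j<n. of_bool ((vs ! i, vs ! j) \<in> parcs ?H))"
    \<comment> \<open>The same enumeration \<open>vs\<close> labels both adjacency matrices, so that
      they can be added entry by entry.\<close>
    by (rule adjacency_psd_split[OF pair_graph_complement[OF G] vs(1) vs', unfolded len])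
      (rule that)
  have irrefl: "(x, x) \<notin> parcs G" for x using pair_no_loops by fastforce
  have J: "of_bool ((vs ! i, vs ! j) \<in> parcs G) + of_bool ((vs ! i, vs ! j) \<in> parcs ?H) =
      (if i = j then 0 else (1 :: real))" if ij: "i < n" "j < n" for i j
  proof (cases "i = j")
    case True
    then show ?thesis by (simp add: irrefl graph_complement_def)
  next
    case False
    then have "vs ! i \<noteq> vs ! j" using ij vs len by (simp add: nth_eq_iff_index_eq)
    moreover have "vs ! i \<in> pverts G" "vs ! j \<in> pverts G" using ij vs len nth_mem by blast+
    ultimately show ?thesis using False by (simp add: graph_complement_def)
  qed
  have "s_plus G + s_minus G + (s_plus ?H + s_minus ?H) = (\<Sum>i<n. \<Sum>j<n. if i = j then 0 else 1)"
    unfolding PN(6) QM(6) sum.distrib[symmetric] by (intro sum.cong refl) (simp add: J)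
  also have "\<dots> = (\<Sum>i<n. \<Sum>j<n. 1 - (if i = j then 1 else 0))"
    by (intro sum.cong) auto
  also have "\<dots> = real n * (real n - 1)"
    by (simp add: sum_subtractf algebra_simps)
  finally show total: ?total .
  assume "n \<ge> 2"
  then show "(real n - 1)\<^sup>2 / 2 < s_plus G + s_plus ?H"
    using sum_psd_positive_parts_gt[of n P Q N M] total
    by (simp add: PN QM J)
qed

text \<open>The conjecture is assumed for graphs on natural numbers, since a hypothesis cannot
  quantify over vertex types. Relabelling vertices by their positions in \<open>vs\<close> preserves
  the adjacency matrix and commutes with complementation.\<close>

lemma nat_copy:
  assumes G: "pair_graph G"
  obtains H :: "nat pair_pre_digraph" where "pair_graph H" "card (pverts H) = card (pverts G)"
    "s_minus H = s_minus G" "s_minus (graph_complement H) = s_minus (graph_complement G)"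
proof -
  interpret pair_graph G by fact
  obtain vs where vs: "distinct vs" "set vs = pverts G"
    using finite_distinct_list[of "pverts G"] by auto
  define copy :: "'a pair_pre_digraph \<Rightarrow> nat pair_pre_digraph" where
    "copy K = \<lparr> pverts = {..<length vs},
      parcs = {(i, j). i < length vs \<and> j < length vs \<and> (vs ! i, vs ! j) \<in> parcs K} \<rparr>" for K
  have s_copy: "s_minus (copy K) = s_minus K" if "pverts K = pverts G" for K
  proof -
    have "adj_mat_list (copy K) [0..<length vs] = adj_mat_list K vs"
      by (rule eq_matI) (auto simp: adj_mat_list_def copy_def)
    moreover have "set [0..<length vs] = pverts (copy K)" by (auto simp: copy_def)
    ultimately show ?thesis
      using s_minus_eq_char_poly_adj_mat_list[of "[0..<length vs]" "copy K"]
        s_minus_eq_char_poly_adj_mat_list[of vs K] vs that by simp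
  qed
  have "finite (parcs (copy G))"
    by (rule finite_subset[of _ "{..<length vs} \<times> {..<length vs}"]) (auto simp: copy_def)
  moreover have "(x, x) \<notin> parcs G" for x using pair_no_loops by fastforce
  moreover have "sym (parcs G)" using pair_sym_arcs by (simp add: symmetric_def)
  then have "(x, y) \<in> parcs G \<longleftrightarrow> (y, x) \<in> parcs G" for x y by (auto dest: symD)
  ultimately have "pair_graph (copy G)"
    by unfold_locales (auto simp: copy_def symmetric_def sym_def)
  moreover have "graph_complement (copy G) = copy (graph_complement G)"
  proof -
    have "vs ! i = vs ! j \<longleftrightarrow> i = j" if "i < length vs" "j < length vs" for i j
      using vs(1) that by (rule nth_eq_iff_index_eq)
    moreover have "vs ! i \<in> pverts G" if "i < length vs" for i
      using that vs(2) nth_mem by blast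
    ultimately show ?thesis by (auto simp: copy_def graph_complement_def)
  qed
  moreover have "pverts (graph_complement G) = pverts G" by (simp add: graph_complement_def)
  moreover have "card (pverts (copy G)) = card (pverts G)"
    using distinct_card[OF vs(1)] vs(2) by (simp add: copy_def)
  ultimately show thesis using that[of "copy G"] s_copy by simp
qed

text \<open>The strict bound is guarded because it fails for smaller graphs: both values of
  \<open>s_plus\<close> vanish when \<open>n\<close> is 0 or 1, while the left-hand side is 1/2 or
  0. The upper bound holds for every \<open>n\<close>.\<close>

theorem theorem4:
  fixes G :: "'a pair_pre_digraph" and n :: nat
  assumes conjecture:
    "\<forall>H :: nat pair_pre_digraph. pair_graph H \<and> Digraph_Component.connected (with_proj H) \<longrightarrow>
       min (s_plus H) (s_minus H) \<ge> real (card (pverts H)) - 1"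
    and "pair_graph G"
    and "card (pverts G) = n"
  shows "(n \<ge> 2 \<longrightarrow> (real n - 1)\<^sup>2 / 2 < s_plus G + s_plus (graph_complement G)) \<and>
         s_plus G + s_plus (graph_complement G) \<le> (real n - 1)\<^sup>2"
proof
  show "n \<ge> 2 \<longrightarrow> (real n - 1)\<^sup>2 / 2 < s_plus G + s_plus (graph_complement G)"
    using s_plus_complement_gt[OF assms(2,3)] by blast
  have "real n - 1 \<le> s_minus G + s_minus (graph_complement G)"
  \<comment> \<open>The empty graph is not connected, so the conjecture says nothing about it; there
    the bound is -1 and nonnegativity suffices.\<close>
  proof (cases "n = 0")
    case True
    then show ?thesis using s_minus_nonneg[of G] s_minus_nonneg[of "graph_complement G"] by simp
  next
    case False
    obtain H :: "nat pair_pre_digraph" where H: "pair_graph H" "card (pverts H) = card (pverts G)"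
      "s_minus H = s_minus G" "s_minus (graph_complement H) = s_minus (graph_complement G)"
      using nat_copy[OF assms(2)] .
    have conn: "real n - 1 \<le> s_minus K"
      if "pair_graph K" "Digraph_Component.connected (with_proj K)" "card (pverts K) = n"
      for K :: "nat pair_pre_digraph"
      using conjecture that by auto
    have "card (pverts (graph_complement H)) = n"
      using H(2) assms(3) by (simp add: graph_complement_def)
    moreover have "pverts H \<noteq> {}" using False H(2) assms(3) by auto
    ultimately have "real n - 1 \<le> s_minus H \<or> real n - 1 \<le> s_minus (graph_complement H)"
      using connected_or_complement_connected[OF H(1)] conn[OF H(1)]
        conn[OF pair_graph_complement[OF H(1)]] H(2) assms(3) by presburger
    then show ?thesis
      using H s_minus_nonneg[of G] s_minus_nonneg[of "graph_complement G"] by auto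
  qed
  \<comment> \<open>Subtracting \<open>n - 1\<close> from the total \<open>n * (n - 1)\<close>
    leaves exactly the square of \<open>n - 1\<close>.\<close>
  then show "s_plus G + s_plus (graph_complement G) \<le> (real n - 1)\<^sup>2"
    using s_total_complement[OF assms(2,3)] by (simp add: power2_eq_square algebra_simps)
qed

end
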